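(* Let $G$ be a graph and let $m,n\in\mathbb{N}$ with $m<n$. Then \[\omega(G^{\frac{m}{n}})=\begin{cases} m+1 & \text{if } \Delta(G)=1,\\ \frac{m}{2}\Delta(G)+1 & \text{if } \Delta(G)\geq 2 \text{ and } m\equiv 0 \pmod 2,\\ \frac{m-1}{2}\Delta(G)+2 & \text{if } \Delta(G)\geq 2 \text{ and } m\equiv 1 \pmod 2.\end{cases}\]
   Context: All graphs are finite and simple. $\Delta(G)$ is the maximum degree and $\omega(H)$ the clique number of a graph $H$. For $k\in\mathbb{N}$, the $k$-power $H^k$ of a graph $H$ has vertex set $V(H)$, with two distinct vertices $x,y$ adjacent iff $1\le d_H(x,y)\le k$. For $n\in\mathbb{N}$, the $n$-subdivision $G^{\frac1n}$ is obtained from $G$ by replacing each edge by a path of length $n$ (with $n-1$ new internal vertices per edge). The fractional power $G^{\frac{m}{n}}$ is defined as $(G^{\frac1n})^m$, the $m$-power of the $n$-subdivision of $G$. *)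

theory Defs
  imports "Graph_Theory.Pair_Digraph" "Graph_Theory.Shortest_Path"
begin

text \<open>
  A finite simple graph is a \<^locale>\<open>pair_graph\<close>: a finite symmetric digraph without loops, every
  undirected edge being represented by its two arcs.
\<close>

text \<open>\<open>SUP\<close> is the maximum here; on \<^typ>\<open>nat\<close> it gives 0 for the graph without vertices.\<close>

definition max_degree :: "'a pair_pre_digraph \<Rightarrow> nat" where
  "max_degree G = (SUP v\<in>pverts G. out_degree (with_proj G) v)"

definition is_clique :: "'a pair_pre_digraph \<Rightarrow> 'a set \<Rightarrow> bool" where
  "is_clique G K \<longleftrightarrow> K \<subseteq> pverts G \<and> (\<forall>x\<in>K. \<forall>y\<in>K. x \<noteq> y \<longrightarrow> (x, y) \<in> parcs G)"

definition clique_number :: "'a pair_pre_digraph \<Rightarrow> nat" where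
  "clique_number G = Max {card K |K. is_clique G K}"

text \<open>The distance is the least number of arcs of a walk, infinite if there is no walk.\<close>

definition graph_dist :: "'a pair_pre_digraph \<Rightarrow> 'a \<Rightarrow> 'a \<Rightarrow> ereal" where
  "graph_dist G = wf_digraph.\<mu> (with_proj G) (\<lambda>_. 1)"

definition graph_power :: "nat \<Rightarrow> 'a pair_pre_digraph \<Rightarrow> 'a pair_pre_digraph" where
  "graph_power k G =
     \<lparr> pverts = pverts G,
       parcs = {(x, y). x \<in> pverts G \<and> y \<in> pverts G \<and> x \<noteq> y \<and>
                        1 \<le> graph_dist G x y \<and> graph_dist G x y \<le> ereal (real k)} \<rparr>"

text \<open>
  \<open>subdiv_point n u v i\<close> is the \<open>i\<close>-th vertex, counted from \<open>u\<close>, of the path of length \<open>n\<close> that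
  replaces the edge \<open>uv\<close>. An inner vertex of this path is labelled by its distances to both ends,
  so that \<open>subdiv_point n u v i = subdiv_point n v u (n - i)\<close>: the two arcs of an edge share one path.
\<close>

datatype 'a subdiv_vertex = Branch 'a | Inner "('a \<times> nat) set"

definition subdiv_point :: "nat \<Rightarrow> 'a \<Rightarrow> 'a \<Rightarrow> nat \<Rightarrow> 'a subdiv_vertex" where
  "subdiv_point n u v i =
     (if i = 0 then Branch u else if i = n then Branch v else Inner {(u, i), (v, n - i)})"

definition edge_subdivision :: "nat \<Rightarrow> 'a pair_pre_digraph \<Rightarrow> 'a subdiv_vertex pair_pre_digraph" where
  "edge_subdivision n G =
     \<lparr> pverts = Branch ` pverts G \<union> {subdiv_point n u v i |u v i. (u, v) \<in> parcs G \<and> i \<le> n},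
       parcs = {(subdiv_point n u v i, subdiv_point n u v j) |u v i j.
                  (u, v) \<in> parcs G \<and> i \<le> n \<and> j \<le> n \<and> (j = Suc i \<or> i = Suc j)} \<rparr>"

definition fractional_power ::
    "nat \<Rightarrow> nat \<Rightarrow> 'a pair_pre_digraph \<Rightarrow> 'a subdiv_vertex pair_pre_digraph" where
  "fractional_power m n G = graph_power m (edge_subdivision n G)"

lemma subdiv_point_swap:
  assumes "0 < n" "i \<le> n"
  shows "subdiv_point n u v i = subdiv_point n v u (n - i)"
  using assms by (auto simp: subdiv_point_def)

lemma subdiv_point_Suc_neq:
  assumes "u \<noteq> v" "i < n"
  shows "subdiv_point n u v i \<noteq> subdiv_point n u v (Suc i)"
  using assms by (auto simp: subdiv_point_def doubleton_eq_iff)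

lemma pair_graph_edge_subdivision:
  assumes "pair_graph G"
  shows "pair_graph (edge_subdivision n G)"
proof -
  interpret G: pair_graph G by fact
  have fv: "finite (pverts (edge_subdivision n G))"
  proof -
    have "{subdiv_point n u v i |u v i. (u, v) \<in> parcs G \<and> i \<le> n} \<subseteq>
        (\<lambda>(e, i). subdiv_point n (fst e) (snd e) i) ` (parcs G \<times> {..n})"
      by (force simp: image_iff)
    then have "finite {subdiv_point n u v i |u v i. (u, v) \<in> parcs G \<and> i \<le> n}"
      by (rule finite_subset) (simp add: G.pair_finite_arcs)
    then show ?thesis
      by (simp add: edge_subdivision_def G.pair_finite_verts)
  qed
  have wf: "fst e \<in> pverts (edge_subdivision n G) \<and> snd e \<in> pverts (edge_subdivision n G)"
    if "e \<in> parcs (edge_subdivision n G)" for e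
    using that unfolding edge_subdivision_def by clarsimp blast
  then have "parcs (edge_subdivision n G) \<subseteq> pverts (edge_subdivision n G) \<times> pverts (edge_subdivision n G)"
    by (auto simp: mem_Times_iff)
  then have fa: "finite (parcs (edge_subdivision n G))"
    using fv by (meson finite_SigmaI finite_subset)
  have noloop: "fst e \<noteq> snd e" if "e \<in> parcs (edge_subdivision n G)" for e
  proof -
    from that obtain u v i j where e: "e = (subdiv_point n u v i, subdiv_point n u v j)"
      and uv: "(u, v) \<in> parcs G" and ij: "i \<le> n" "j \<le> n" "j = Suc i \<or> i = Suc j"
      by (auto simp: edge_subdivision_def)
    have "u \<noteq> v"
      using uv by (rule G.no_loops')
    then show ?thesis
      using ij subdiv_point_Suc_neq[of u v i n] subdiv_point_Suc_neq[of u v j n]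
      by (auto simp: e)
  qed
  have sym: "symmetric (with_proj (edge_subdivision n G))"
    unfolding symmetric_def with_proj_simps edge_subdivision_def by (rule symI) (clarsimp, blast)
  show ?thesis
    by unfold_locales (use wf fv fa noloop sym in auto)
qed

text \<open>The path of an edge has \<open>n - 1\<close> inner vertices, and the paths of distinct edges share none.\<close>

lemma subdiv_point_eq_iff:
  assumes "u \<noteq> v" "u' \<noteq> v'" "0 < i" "i < n" "j \<le> n"
  shows "subdiv_point n u v i = subdiv_point n u' v' j \<longleftrightarrow>
    (u = u' \<and> v = v' \<and> i = j) \<or> (u = v' \<and> v = u' \<and> i + j = n)"
  using assms by (auto simp: subdiv_point_def doubleton_eq_iff)

end

theory Submission
  imports Defs
begin

text \<open>
  A walk of length at most \<open>m < n\<close> in the subdivision meets at most one branch vertex in its interior,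
  so two adjacent points of the power lie on a common edge, or on two edges at a common branch
  vertex from which their distances sum to at most \<open>m\<close>. As every cycle has
  length at least \<open>3 n > 3 m\<close>, a clique then lies on one edge, which gives
  \<open>m + 1\<close> points, or in the star of one branch vertex. In a star, at most one leg carries a point
  at distance \<open>a > m div 2\<close> from the centre; all other legs then reach at most to distance \<open>m - a\<close>,
  and the optimum is the ball of radius \<open>m div 2\<close>, with one further point if \<open>m\<close> is odd.
\<close>

section \<open>Walks in a subdivision\<close>

text \<open>An inner point determines its edge up to orientation, a branch vertex only itself, which
  gives the last two cases. The bound \<open>l < n\<close> leaves \<open>Branch a\<close> as the
  only branch vertex on the right.\<close>

lemma subdiv_point_eq_cases:
  assumes "subdiv_point n u v j = subdiv_point n a b l" "u \<noteq> v" "a \<noteq> b" "j \<le> n" "l < n"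
  shows "(a = u \<and> b = v \<and> l = j) \<or> (a = v \<and> b = u \<and> l = n - j \<and> 0 < j) \<or>
    (a = u \<and> j = 0 \<and> l = 0) \<or> (a = v \<and> j = n \<and> l = 0)"
  using assms by (auto simp: subdiv_point_def doubleton_eq_iff split: if_splits)

text \<open>For \<open>k = n\<close>, the relation \<open>edge_near\<close> says just that the points lie on a common edge.\<close>

definition edge_near :: "'a pair_pre_digraph \<Rightarrow> nat \<Rightarrow> nat \<Rightarrow> 'a subdiv_vertex \<Rightarrow> 'a subdiv_vertex \<Rightarrow> bool" where
  "edge_near G n k x y \<longleftrightarrow> (\<exists>u v i j. (u, v) \<in> parcs G \<and> i \<le> n \<and> j \<le> n \<and>
     x = subdiv_point n u v i \<and> y = subdiv_point n u v j \<and> i \<le> j + k \<and> j \<le> i + k)"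

text \<open>The two legs may coincide, since a step away from \<open>u\<close> may lead onto the leg
  of \<open>x\<close> again. The indices stay within the legs through \<open>i + j \<le> k\<close>,
  as \<open>k \<le> n\<close> in all uses.\<close>

definition star_near :: "'a pair_pre_digraph \<Rightarrow> nat \<Rightarrow> nat \<Rightarrow> 'a subdiv_vertex \<Rightarrow> 'a subdiv_vertex \<Rightarrow> bool" where
  "star_near G n k x y \<longleftrightarrow> (\<exists>u v w i j. (u, v) \<in> parcs G \<and> (u, w) \<in> parcs G \<and>
     x = subdiv_point n u v i \<and> y = subdiv_point n u w j \<and> i + j \<le> k)"

lemma edge_near_mono: "edge_near G n k x y \<Longrightarrow> k \<le> l \<Longrightarrow> edge_near G n l x y"
  unfolding edge_near_def by (elim exE, intro exI conjI) auto

lemma star_near_mono: "star_near G n k x y \<Longrightarrow> k \<le> l \<Longrightarrow> star_near G n l x y"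
  unfolding star_near_def by (elim exE, intro exI conjI) (elim conjE, assumption | simp)+

context pair_graph
begin

lemma pair_arc_neq: "(u, v) \<in> parcs G \<Longrightarrow> u \<noteq> v"
  by (rule no_loops')

lemma pair_arc_swap: "(u, v) \<in> parcs G \<Longrightarrow> (v, u) \<in> parcs G"
  using arcs_symmetric by blast

text \<open>A backward step along \<open>uv\<close> is a forward step along \<open>vu\<close>, and
  both arcs are in \<open>G\<close>; so every arc can be taken as a forward step.\<close>

lemma parcs_edge_subdivision:
  "parcs (edge_subdivision n G) =
    {(subdiv_point n u v i, subdiv_point n u v (Suc i)) |u v i. (u, v) \<in> parcs G \<and> i < n}"
  (is "_ = ?R")
proof (rule set_eqI)
  fix e :: "'a subdiv_vertex \<times> 'a subdiv_vertex"
  have R: "(subdiv_point n u v i, subdiv_point n u v (Suc i)) \<in> ?R"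
    if "(u, v) \<in> parcs G" "i < n" for u v i
    using that by blast
  show "e \<in> parcs (edge_subdivision n G) \<longleftrightarrow> e \<in> ?R"
  proof
    assume "e \<in> parcs (edge_subdivision n G)"
    then obtain u v i j where e: "e = (subdiv_point n u v i, subdiv_point n u v j)"
      and uv: "(u, v) \<in> parcs G" and ij: "i \<le> n" "j \<le> n" "j = Suc i \<or> i = Suc j"
      by (auto simp: edge_subdivision_def)
    from ij(3) show "e \<in> ?R"
    proof
      assume "j = Suc i"
      then show ?thesis using e R[OF uv, of i] ij by simp
    next
      assume i: "i = Suc j"
      then have "e = (subdiv_point n v u (n - i), subdiv_point n v u (Suc (n - i)))"
        using e ij subdiv_point_swap[of n i u v] subdiv_point_swap[of n j u v]
        by (simp add: Suc_diff_Suc)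
      moreover have "n - i < n" using i ij by simp
      ultimately show ?thesis using R[OF pair_arc_swap[OF uv]] by blast
    qed
  next
    assume "e \<in> ?R"
    then show "e \<in> parcs (edge_subdivision n G)"
      by (fastforce simp: edge_subdivision_def)
  qed
qed

lemma edge_subdivision_arcI:
  "(u, v) \<in> parcs G \<Longrightarrow> i < n \<Longrightarrow>
    (subdiv_point n u v i, subdiv_point n u v (Suc i)) \<in> parcs (edge_subdivision n G)"
  unfolding parcs_edge_subdivision by blast

lemma subdiv_point_in_verts:
  assumes "(u, v) \<in> parcs G" "i \<le> n"
  shows "subdiv_point n u v i \<in> pverts (edge_subdivision n G)"
proof -
  have "subdiv_point n u v i \<in> {subdiv_point n u v i |u v i. (u, v) \<in> parcs G \<and> i \<le> n}"
    using assms by blast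
  then show ?thesis
    by (simp add: edge_subdivision_def)
qed

text \<open>A step at an inner point stays on its edge, and a step away from a branch vertex opens a
  leg of a star centred there. The star persists because \<open>y\<close>, at index at most
  \<open>k < n\<close>, is not the far end of its leg.\<close>

lemma near_step:
  assumes near: "edge_near G n k x y \<or> star_near G n k x y"
    and yz: "(y, z) \<in> parcs (edge_subdivision n G)" and k: "k < n"
  shows "edge_near G n (Suc k) x z \<or> star_near G n (Suc k) x z"
proof -
  obtain a b l where y: "y = subdiv_point n a b l" and z: "z = subdiv_point n a b (Suc l)"
    and ab: "(a, b) \<in> parcs G" and l: "l < n"
    using yz by (auto simp: parcs_edge_subdivision)
  \<comment> \<open>In the reversed orientation \<open>l = n - j\<close>, the step lowers the index
    \<open>j\<close> that is counted from \<open>b\<close>.\<close>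
  have pred: "z = subdiv_point n b a (j - 1)" if "l = n - j" "0 < j" "j \<le> n" for j
    using z that subdiv_point_swap[of n "Suc l" a b] l by (simp add: Suc_diff_Suc)
  have new: "subdiv_point n a v 0 = y" if "l = 0" for v
    using that y by (simp add: subdiv_point_def)
  from near show ?thesis
  proof
    assume "edge_near G n k x y"
    then obtain u v i j where uv: "(u, v) \<in> parcs G" and ij: "i \<le> n" "j \<le> n" "i \<le> j + k" "j \<le> i + k"
      and x: "x = subdiv_point n u v i" and y': "y = subdiv_point n u v j"
      unfolding edge_near_def by blast
    have "subdiv_point n u v j = subdiv_point n a b l" using y y' by simp
    then consider "a = u" "b = v" "l = j" | "a = v" "b = u" "l = n - j" "0 < j"
      | "a = u" "j = 0" "l = 0" | "a = v" "j = n" "l = 0"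
      using subdiv_point_eq_cases[of n u v j a b l] pair_arc_neq[OF uv] pair_arc_neq[OF ab] ij l
      by blast
    then show ?thesis
    proof cases
      case 1
      then have "edge_near G n (Suc k) x z"
        unfolding edge_near_def using uv ij x z l
        by (intro exI[of _ u] exI[of _ v] exI[of _ i] exI[of _ "Suc j"]) auto
      then show ?thesis ..
    next
      case 2
      then have "edge_near G n (Suc k) x z"
        unfolding edge_near_def using uv ij x pred[of j]
        by (intro exI[of _ u] exI[of _ v] exI[of _ i] exI[of _ "j - 1"]) auto
      then show ?thesis ..
    next
      case 3
      \<comment> \<open>Now \<open>y\<close> is the branch vertex \<open>u\<close>, and
        \<open>x\<close> has index \<open>i \<le> k\<close> from it.\<close>
      then have "star_near G n (Suc k) x z"
        unfolding star_near_def using uv ij x z ab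
        by (intro exI[of _ u] exI[of _ v] exI[of _ b] exI[of _ i] exI[of _ "Suc 0"]) auto
      then show ?thesis ..
    next
      case 4
      \<comment> \<open>Now \<open>y\<close> is the end \<open>v\<close>; counted from
        \<open>v\<close>, the point \<open>x\<close> has index \<open>n - i \<le> k\<close>.\<close>
      then have "star_near G n (Suc k) x z"
        unfolding star_near_def using pair_arc_swap[OF uv] ij x z ab subdiv_point_swap[of n i u v] l
        by (intro exI[of _ v] exI[of _ u] exI[of _ b] exI[of _ "n - i"] exI[of _ "Suc 0"]) auto
      then show ?thesis ..
    qed
  next
    assume "star_near G n k x y"
    then obtain u v w i j where uv: "(u, v) \<in> parcs G" and uw: "(u, w) \<in> parcs G" and ij: "i + j \<le> k"
      and x: "x = subdiv_point n u v i" and y': "y = subdiv_point n u w j"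
      unfolding star_near_def by blast
    have "subdiv_point n u w j = subdiv_point n a b l" using y y' by simp
    \<comment> \<open>The far end \<open>j = n\<close> is impossible since
      \<open>j \<le> k < n\<close>.\<close>
    then consider "a = u" "b = w" "l = j" | "a = w" "b = u" "l = n - j" "0 < j"
      | "a = u" "j = 0" "l = 0"
      using subdiv_point_eq_cases[of n u w j a b l] pair_arc_neq[OF uw] pair_arc_neq[OF ab] ij l k
      by fastforce
    then have "star_near G n (Suc k) x z"
    proof cases
      case 1
      then show ?thesis
        unfolding star_near_def using uv uw ij x z
        by (intro exI[of _ u] exI[of _ v] exI[of _ w] exI[of _ i] exI[of _ "Suc j"]) auto
    next
      case 2
      then show ?thesis
        unfolding star_near_def using uv uw ij x pred[of j] k
        by (intro exI[of _ u] exI[of _ v] exI[of _ w] exI[of _ i] exI[of _ "j - 1"]) auto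
    next
      case 3
      then show ?thesis
        unfolding star_near_def using uv ij x z ab
        by (intro exI[of _ u] exI[of _ v] exI[of _ b] exI[of _ i] exI[of _ "Suc 0"]) auto
    qed
    then show ?thesis ..
  qed
qed

text \<open>Induction splits off the last arc. The assumption \<open>x \<noteq> y\<close> excludes
  the empty walk at an isolated branch vertex, which lies on no edge; if the walk is back at
  \<open>x\<close> before its last arc, this arc alone gives the relation.\<close>

lemma relpow_edge_subdivision_near:
  assumes "(x, y) \<in> parcs (edge_subdivision n G) ^^ k" "k \<le> n" "x \<noteq> y"
  shows "edge_near G n k x y \<or> star_near G n k x y"
  using assms
proof (induction k arbitrary: y)
  case (Suc k)
  then obtain z where xz: "(x, z) \<in> parcs (edge_subdivision n G) ^^ k"
    and zy: "(z, y) \<in> parcs (edge_subdivision n G)"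
    by auto
  show ?case
  proof (cases "x = z")
    case True
    obtain a b l where "z = subdiv_point n a b l" "y = subdiv_point n a b (Suc l)"
      "(a, b) \<in> parcs G" "l < n"
      using zy by (auto simp: parcs_edge_subdivision)
    then have "edge_near G n (Suc k) x y"
      unfolding edge_near_def True
      by (intro exI[of _ a] exI[of _ b] exI[of _ l] exI[of _ "Suc l"]) auto
    then show ?thesis ..
  next
    case False
    then show ?thesis
      using near_step[OF Suc.IH[OF xz] zy] Suc.prems by simp
  qed
qed auto

section \<open>Walks of prescribed length along edges\<close>

lemma relpow_along_edge:
  assumes "(u, v) \<in> parcs G" "i + k \<le> n"
  shows "(subdiv_point n u v i, subdiv_point n u v (i + k)) \<in> parcs (edge_subdivision n G) ^^ k"
  using assms(2)
proof (induction k)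
  case (Suc k)
  then have "(subdiv_point n u v (i + k), subdiv_point n u v (i + Suc k)) \<in> parcs (edge_subdivision n G)"
    unfolding add_Suc_right by (intro edge_subdivision_arcI assms(1)) simp
  then show ?case
    using Suc by auto
qed simp

lemma relpow_along_edge_rev:
  assumes "(u, v) \<in> parcs G" "i + k \<le> n"
  shows "(subdiv_point n u v (i + k), subdiv_point n u v i) \<in> parcs (edge_subdivision n G) ^^ k"
proof (cases "n = 0")
  case False
  have eq: "n - (i + k) + k = n - i"
    using assms(2) by simp
  show ?thesis
    using False relpow_along_edge[OF pair_arc_swap[OF assms(1)], of "n - (i + k)" k n] assms(2)
      subdiv_point_swap[of n i u v] subdiv_point_swap[of n "i + k" u v] eq
    by simp
qed (use assms in simp)

lemma relpow_through_branch:
  assumes "(u, v) \<in> parcs G" "(u, w) \<in> parcs G" "i \<le> n" "j \<le> n"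
  shows "(subdiv_point n u v i, subdiv_point n u w j) \<in> parcs (edge_subdivision n G) ^^ (i + j)"
proof -
  have "(subdiv_point n u v i, subdiv_point n u v 0) \<in> parcs (edge_subdivision n G) ^^ i"
    using relpow_along_edge_rev[OF assms(1), of 0 i n] assms(3) by simp
  moreover have "(subdiv_point n u v 0, subdiv_point n u w j) \<in> parcs (edge_subdivision n G) ^^ j"
    using relpow_along_edge[OF assms(2), of 0 j n] assms(4) by (simp add: subdiv_point_def)
  ultimately show ?thesis
    by (auto simp: relpow_add)
qed

section \<open>Graph powers\<close>

text \<open>Relation powers make walks accessible to induction at either end. The power 0 is the
  identity on the whole type, whereas an empty walk needs a vertex; hence
  \<open>x \<in> pverts G\<close>.\<close>

lemma relpow_iff_awalk:
  "x \<in> pverts G \<Longrightarrow> (x, y) \<in> parcs G ^^ k \<longleftrightarrow> (\<exists>p. awalk x p y \<and> length p = k)"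
proof (induction k arbitrary: x)
  case 0
  then show ?case by (auto simp: awalk_Nil_iff)
next
  case (Suc k)
  have "(x, y) \<in> parcs G ^^ Suc k \<longleftrightarrow> (\<exists>z. (x, z) \<in> parcs G \<and> (z, y) \<in> parcs G ^^ k)"
    by (auto simp: relpow_commute[symmetric])
  also have "\<dots> \<longleftrightarrow> (\<exists>z. (x, z) \<in> parcs G \<and> (\<exists>p. awalk z p y \<and> length p = k))"
    using Suc.IH in_arcsD2 by blast
  also have "\<dots> \<longleftrightarrow> (\<exists>p. awalk x p y \<and> length p = Suc k)"
  proof
    assume "\<exists>z. (x, z) \<in> parcs G \<and> (\<exists>p. awalk z p y \<and> length p = k)"
    then obtain z p where "(x, z) \<in> parcs G" "awalk z p y" "length p = k" by blast
    then show "\<exists>p. awalk x p y \<and> length p = Suc k"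
      by (intro exI[of _ "(x, z) # p"]) (simp add: awalk_Cons_iff)
  next
    assume "\<exists>p. awalk x p y \<and> length p = Suc k"
    then obtain e p where "awalk x (e # p) y" "length p = k"
      by (auto simp: length_Suc_conv)
    then show "\<exists>z. (x, z) \<in> parcs G \<and> (\<exists>p. awalk z p y \<and> length p = k)"
      by (cases e) (auto simp: awalk_Cons_iff)
  qed
  finally show ?case .
qed

lemma awalk_cost_one: "awalk_cost (\<lambda>_. 1) p = real (length p)"
  by (induction p) auto

lemma graph_dist_le_iff:
  assumes "x \<in> pverts G"
  shows "graph_dist G x y \<le> ereal (real m) \<longleftrightarrow> (\<exists>k\<le>m. (x, y) \<in> parcs G ^^ k)"
proof -
  have "graph_dist G x y \<le> ereal (real m) \<longleftrightarrow> (\<exists>p. awalk x p y \<and> length p \<le> m)"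
  proof
    assume "graph_dist G x y \<le> ereal (real m)"
    \<comment> \<open>The strict bound lets \<open>INF_less_iff\<close> supply a walk; as its length
      is an integer, \<open>< m + 1\<close> then means \<open>\<le> m\<close>.\<close>
    then have "graph_dist G x y < ereal (real m + 1)"
      by (rule le_less_trans) simp
    then obtain p where "awalk x p y" "real (length p) < real m + 1"
      unfolding graph_dist_def \<mu>_def INF_less_iff by (auto simp: awalk_cost_one)
    then show "\<exists>p. awalk x p y \<and> length p \<le> m"
      by (intro exI[of _ p]) simp
  next
    assume "\<exists>p. awalk x p y \<and> length p \<le> m"
    then obtain p where "awalk x p y" "length p \<le> m" by blast
    then show "graph_dist G x y \<le> ereal (real m)"
      unfolding graph_dist_def \<mu>_def
      by (intro INF_lower2[of p]) (auto simp: awalk_cost_one)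
  qed
  then show ?thesis
    using relpow_iff_awalk[OF assms] by auto
qed

lemma graph_dist_ge_1:
  assumes "x \<noteq> y"
  shows "1 \<le> graph_dist G x y"
proof -
  show ?thesis
    unfolding graph_dist_def \<mu>_def
  proof (rule INF_greatest)
    fix p assume "p \<in> {p. awalk x p y}"
    then have "p \<noteq> []" using assms by (auto simp: awalk_Nil_iff)
    then have "1 \<le> length p" by (cases p) auto
    then show "1 \<le> ereal (awalk_cost (\<lambda>_. 1) p)"
      by (simp add: awalk_cost_one one_ereal_def)
  qed
qed

lemma parcs_graph_power:
  "(x, y) \<in> parcs (graph_power m G) \<longleftrightarrow>
    x \<in> pverts G \<and> y \<in> pverts G \<and> x \<noteq> y \<and> (\<exists>k\<le>m. (x, y) \<in> parcs G ^^ k)"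
  using graph_dist_ge_1 graph_dist_le_iff by (auto simp: graph_power_def)

end

text \<open>From here on, the distance enters only as the existence of a walk with at most
  \<open>m\<close> arcs.\<close>

lemma is_clique_fractional_power:
  assumes "pair_graph G"
  shows "is_clique (fractional_power m n G) K \<longleftrightarrow> K \<subseteq> pverts (edge_subdivision n G) \<and>
    (\<forall>x\<in>K. \<forall>y\<in>K. x \<noteq> y \<longrightarrow> (\<exists>k\<le>m. (x, y) \<in> parcs (edge_subdivision n G) ^^ k))"
proof -
  interpret S: pair_graph "edge_subdivision n G"
    by (rule pair_graph_edge_subdivision[OF assms])
  have "pverts (fractional_power m n G) = pverts (edge_subdivision n G)"
    by (simp add: fractional_power_def graph_power_def)
  then show ?thesis
    unfolding is_clique_def using S.parcs_graph_power[of _ _ m]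
    by (auto simp: fractional_power_def; blast)
qed

lemma clique_number_eqI:
  assumes "finite (pverts H)" "\<And>K. is_clique H K \<Longrightarrow> card K \<le> b" "is_clique H L" "b \<le> card L"
  shows "clique_number H = b"
proof -
  have "{K. is_clique H K} \<subseteq> Pow (pverts H)"
    by (auto simp: is_clique_def)
  then have "finite (card ` {K. is_clique H K})"
    using assms(1) by (meson finite_Pow_iff finite_imageI finite_subset)
  then have "finite {card K |K. is_clique H K}"
    by (simp add: setcompr_eq_image)
  moreover have "b = card L"
    using assms by (simp add: le_antisym)
  ultimately show ?thesis
    unfolding clique_number_def using assms by (intro Max_eqI) auto
qed

section \<open>Cliques\<close>

text \<open>Here \<open>A v\<close> stands for the distances from the centre of the clique points on
  leg \<open>v\<close>. If one leg has largest distance \<open>a > m div 2\<close>, each other leg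
  has at most \<open>m - a\<close> points, so the total is at most
  \<open>a + (D - 1) * (m - a) = m + (D - 2) * (m - a)\<close>, and
  \<open>m - a \<le> m div 2\<close>.\<close>

lemma sum_legs_le:
  fixes A :: "'b \<Rightarrow> nat set"
  assumes N: "finite N" "card N \<le> D" and pos: "\<And>v. v \<in> N \<Longrightarrow> 0 \<notin> A v"
    and cross: "\<And>v w s t. v \<in> N \<Longrightarrow> w \<in> N \<Longrightarrow> v \<noteq> w \<Longrightarrow> s \<in> A v \<Longrightarrow> t \<in> A w \<Longrightarrow> s + t \<le> m"
    and two: "v\<^sub>1 \<in> N" "v\<^sub>2 \<in> N" "v\<^sub>1 \<noteq> v\<^sub>2" "A v\<^sub>1 \<noteq> {}" "A v\<^sub>2 \<noteq> {}"
  shows "(\<Sum>v\<in>N. card (A v)) \<le> (m div 2) * D + m mod 2"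
proof (cases "\<forall>v\<in>N. A v \<subseteq> {1..m div 2}")
  case True
  then have "card (A v) \<le> m div 2" if "v \<in> N" for v
    using that card_mono[of "{1..m div 2}" "A v"] by simp
  then have "(\<Sum>v\<in>N. card (A v)) \<le> card N * (m div 2)"
    using sum_bounded_above[of N "\<lambda>v. card (A v)"] by simp
  also have "\<dots> \<le> (m div 2) * D"
    using N(2) by simp
  finally show ?thesis by simp
next
  case False
  then obtain v b where v: "v \<in> N" "b \<in> A v" "b \<notin> {1..m div 2}" by blast
  have "b \<noteq> 0" using pos v by metis
  then have b: "m div 2 < b" using v(3) by auto
  \<comment> \<open>A second nonempty leg keeps leg \<open>v\<close> below \<open>m\<close>, which
    makes \<open>A v\<close> finite and later gives \<open>a < m\<close>.\<close>
  obtain w where w: "w \<in> N" "w \<noteq> v" "A w \<noteq> {}" using two by metis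
  then obtain t where t: "t \<in> A w" by blast
  have "t \<noteq> 0" using pos w t by metis
  have sub: "A v \<subseteq> {1..m - 1}"
  proof
    fix s assume s: "s \<in> A v"
    then have "s + t \<le> m" using cross[of v w s t] v w t by blast
    moreover have "s \<noteq> 0" using pos v s by metis
    ultimately show "s \<in> {1..m - 1}" using \<open>t \<noteq> 0\<close> by auto
  qed
  then have fin: "finite (A v)" by (rule finite_subset) simp
  define a where "a = Max (A v)"
  have a: "a \<in> A v" "b \<le> a"
    unfolding a_def using fin v(2) by (auto intro: Max_in)
  have am: "a < m"
    using sub a(1) \<open>b \<noteq> 0\<close> a(2) by fastforce
  have "A v \<subseteq> {1..a}"
    using sub fin by (auto simp: a_def)
  then have cv: "card (A v) \<le> a"
    using card_mono[of "{1..a}" "A v"] by simp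
  have cw: "card (A w) \<le> m - a" if "w \<in> N - {v}" for w
  proof -
    have "A w \<subseteq> {1..m - a}"
    proof
      fix s assume s: "s \<in> A w"
      then have "a + s \<le> m" using cross[of v w a s] v a that by blast
      moreover have "s \<noteq> 0" using pos that s by (metis DiffD1)
      ultimately show "s \<in> {1..m - a}" by auto
    qed
    then show ?thesis
      using card_mono[of "{1..m - a}" "A w"] by simp
  qed
  have "card (N - {v}) = card N - 1" "card N \<ge> 2"
    using N v w card_mono[of N "{v, w}"] by auto
  moreover from this have "2 \<le> D" using N(2) by linarith
  then obtain E where E: "D = 2 + E" by (metis le_Suc_ex)
  ultimately have cN: "card (N - {v}) \<le> E + 1"
    using N(2) by linarith
  have "(\<Sum>v\<in>N. card (A v)) = card (A v) + (\<Sum>w\<in>N - {v}. card (A w))"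
    using N v by (simp add: sum.remove)
  also have "\<dots> \<le> a + card (N - {v}) * (m - a)"
    using cv sum_bounded_above[of "N - {v}" "\<lambda>w. card (A w)", OF cw] by simp
  also have "\<dots> \<le> a + (E + 1) * (m - a)"
    using cN by (intro add_left_mono mult_right_mono) auto
  also have "\<dots> = m + E * (m - a)"
    using am by (simp add: distrib_right)
  also have "\<dots> \<le> m + E * (m div 2)"
    using b a(2) by (intro add_left_mono mult_left_mono) auto
  also have "\<dots> = (m div 2) * D + m mod 2"
    using div_mult_mod_eq[of m 2] unfolding E distrib_left mult.commute[of E] by linarith
  finally show ?thesis .
qed

text \<open>Counted from its least element, the set lies in an interval of \<open>m + 1\<close>
  numbers.\<close>

lemma card_le_of_diameter:
  fixes I :: "nat set"
  assumes "\<And>i j. i \<in> I \<Longrightarrow> j \<in> I \<Longrightarrow> i \<le> j + m"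
  shows "card I \<le> m + 1"
proof (cases "I = {}")
  case False
  then have "(LEAST i. i \<in> I) \<in> I" by (metis LeastI ex_in_conv)
  then have "I \<subseteq> {(LEAST i. i \<in> I)..(LEAST i. i \<in> I) + m}"
    using assms by (auto intro: Least_le)
  then show ?thesis
    using card_mono[of "{(LEAST i. i \<in> I)..(LEAST i. i \<in> I) + m}" I] by simp
qed simp

text \<open>Distinct legs at \<open>u\<close> share only \<open>u\<close>, which
  \<open>0 < s\<close> excludes.\<close>

lemma subdiv_point_same_leg:
  assumes "subdiv_point n u v s = subdiv_point n u w t" "u \<noteq> v" "u \<noteq> w" "s \<le> n" "t \<le> n" "0 < s"
  shows "v = w \<and> s = t"
  using assms by (auto simp: subdiv_point_def doubleton_eq_iff split: if_splits)

text \<open>A common inner point lies on the edge \<open>uw\<close>, where \<open>s + t = n\<close>;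
  a common branch vertex cannot be both \<open>u\<close> and \<open>w\<close>, so one of its two
  indices is \<open>n\<close>.\<close>

lemma subdiv_point_two_ends:
  assumes "subdiv_point n u v s = subdiv_point n w x t" "u \<noteq> v" "w \<noteq> x" "u \<noteq> w" "s \<le> n" "t \<le> n"
  shows "n \<le> s + t"
  using assms by (auto simp: subdiv_point_def doubleton_eq_iff split: if_splits)

section \<open>Nearness read off in coordinates\<close>

context pair_graph
begin

text \<open>A star centred at \<open>u\<close> gives \<open>i + j \<le> m\<close>, one centred at
  \<open>v\<close> gives \<open>(n - i) + (n - j) \<le> m\<close>, and either implies the claim; any
  other centre reaches a point of this edge only at index \<open>n > m\<close>. Exchanging
  \<open>i\<close> and \<open>j\<close> gives the other inequality.\<close>

lemma near_on_edge:
  assumes "edge_near G n m (subdiv_point n u v i) (subdiv_point n u v j) \<or>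
      star_near G n m (subdiv_point n u v i) (subdiv_point n u v j)"
    and "(u, v) \<in> parcs G" "i \<le> n" "j \<le> n" "m < n"
  shows "i \<le> j + m"
  using assms(1)
proof
  assume "edge_near G n m (subdiv_point n u v i) (subdiv_point n u v j)"
  then obtain a b k l where "(a, b) \<in> parcs G" "k \<le> n" "l \<le> n" "k \<le> l + m" "l \<le> k + m"
    "subdiv_point n u v i = subdiv_point n a b k" "subdiv_point n u v j = subdiv_point n a b l"
    unfolding edge_near_def by blast
  moreover from this have "a \<noteq> b" using pair_arc_neq by blast
  ultimately show ?thesis
    using pair_arc_neq[OF assms(2)] assms(3-)
    by (auto simp: subdiv_point_def doubleton_eq_iff split: if_splits)
next
  assume "star_near G n m (subdiv_point n u v i) (subdiv_point n u v j)"
  then obtain a b c k l where "(a, b) \<in> parcs G" "(a, c) \<in> parcs G" "k + l \<le> m"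
    "subdiv_point n u v i = subdiv_point n a b k" "subdiv_point n u v j = subdiv_point n a c l"
    unfolding star_near_def by blast
  moreover from this have "a \<noteq> b" "a \<noteq> c" using pair_arc_neq by blast+
  ultimately show ?thesis
    using pair_arc_neq[OF assms(2)] assms(3-)
    by (auto simp: subdiv_point_def doubleton_eq_iff split: if_splits)
qed

text \<open>A common edge exists only for the far ends \<open>v\<close> and \<open>w\<close>, which
  are \<open>n > m\<close> apart on it. A centre other than \<open>u\<close> would have to be
  \<open>v\<close> for the first point and \<open>w\<close> for the second.\<close>

lemma near_on_star:
  assumes "edge_near G n m (subdiv_point n u v i) (subdiv_point n u w j) \<or>
      star_near G n m (subdiv_point n u v i) (subdiv_point n u w j)"
    and "(u, v) \<in> parcs G" "(u, w) \<in> parcs G" "v \<noteq> w" "0 < i" "i \<le> n" "0 < j" "j \<le> n" "m < n"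
  shows "i + j \<le> m"
  using assms(1)
proof
  assume "edge_near G n m (subdiv_point n u v i) (subdiv_point n u w j)"
  then obtain a b k l where "(a, b) \<in> parcs G" "k \<le> n" "l \<le> n" "k \<le> l + m" "l \<le> k + m"
    "subdiv_point n u v i = subdiv_point n a b k" "subdiv_point n u w j = subdiv_point n a b l"
    unfolding edge_near_def by blast
  moreover from this have "a \<noteq> b" using pair_arc_neq by blast
  ultimately show ?thesis
    using pair_arc_neq[OF assms(2)] pair_arc_neq[OF assms(3)] assms(4-)
    by (auto simp: subdiv_point_def doubleton_eq_iff split: if_splits)
next
  assume "star_near G n m (subdiv_point n u v i) (subdiv_point n u w j)"
  then obtain a b c k l where "(a, b) \<in> parcs G" "(a, c) \<in> parcs G" "k + l \<le> m"
    "subdiv_point n u v i = subdiv_point n a b k" "subdiv_point n u w j = subdiv_point n a c l"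
    unfolding star_near_def by blast
  moreover from this have "a \<noteq> b" "a \<noteq> c" using pair_arc_neq by blast+
  ultimately show ?thesis
    using pair_arc_neq[OF assms(2)] pair_arc_neq[OF assms(3)] assms(4-)
    by (auto simp: subdiv_point_def doubleton_eq_iff split: if_splits)
qed

text \<open>An inner point lies on no other edge, so \<open>r\<close> lies on \<open>uv\<close> as
  well, possibly after reversing the orientation.\<close>

lemma edge_near_inner:
  assumes "edge_near G n k (subdiv_point n u v i) r" "(u, v) \<in> parcs G" "0 < i" "i < n"
  obtains s where "s \<le> n" "r = subdiv_point n u v s"
proof -
  obtain a b k l where ab: "(a, b) \<in> parcs G" and kl: "k \<le> n" "l \<le> n"
    and eq: "subdiv_point n u v i = subdiv_point n a b k" and r: "r = subdiv_point n a b l"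
    using assms(1) unfolding edge_near_def by blast
  then consider "a = u" "b = v" | "a = v" "b = u"
    using assms pair_arc_neq by (metis subdiv_point_eq_iff)
  then show thesis
  proof cases
    case 1
    then show ?thesis using that r kl by blast
  next
    case 2
    then show ?thesis using that[of "n - l"] r kl assms subdiv_point_swap[of n l v u] by simp
  qed
qed

text \<open>Branch vertices are at distance at least \<open>n\<close> from each other, so a clique with two elements
  has one in the interior of an edge.\<close>

lemma clique_on_edge:
  assumes pairs: "\<And>x y. x \<in> K \<Longrightarrow> y \<in> K \<Longrightarrow> x \<noteq> y \<Longrightarrow> edge_near G n m x y \<or> star_near G n m x y"
    and common: "\<And>x y. x \<in> K \<Longrightarrow> y \<in> K \<Longrightarrow> x \<noteq> y \<Longrightarrow> edge_near G n n x y"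
    and pq: "p \<in> K" "q \<in> K" "p \<noteq> q" and m: "m < n"
  obtains u v where "(u, v) \<in> parcs G" "K \<subseteq> subdiv_point n u v ` {..n}"
proof -
  note conclude = that
  have inner: thesis if "(u, v) \<in> parcs G" "subdiv_point n u v i \<in> K" "0 < i" "i < n" for u v i
  proof -
    have "r \<in> subdiv_point n u v ` {..n}" if "r \<in> K" for r
    proof (cases "r = subdiv_point n u v i")
      case False
      then have "edge_near G n n (subdiv_point n u v i) r"
        using common[of "subdiv_point n u v i" r] \<open>r \<in> K\<close> \<open>subdiv_point n u v i \<in> K\<close> by metis
      then show ?thesis
        using edge_near_inner \<open>(u, v) \<in> parcs G\<close> \<open>0 < i\<close> \<open>i < n\<close> by (metis atMost_iff imageI)
    qed (use \<open>i < n\<close> in auto)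
    then show thesis using conclude \<open>(u, v) \<in> parcs G\<close> by blast
  qed
  obtain u v i j where uv: "(u, v) \<in> parcs G" and ij: "i \<le> n" "j \<le> n"
    and p: "p = subdiv_point n u v i" and q: "q = subdiv_point n u v j"
    using common[OF pq] unfolding edge_near_def by blast
  have "i \<noteq> j" using pq p q by blast
  moreover have "i \<le> j + m" "j \<le> i + m"
    using near_on_edge[of n m u v i j] near_on_edge[of n m u v j i] uv ij m
      pairs[of p q] pairs[of q p] pq p q by auto
  ultimately have "0 < i \<and> i < n \<or> 0 < j \<and> j < n"
    using ij m by linarith
  then show thesis
    using inner[OF uv] pq p q by blast
qed

text \<open>The Helly property: a clique outside a star would contain three points on a closed walk that
  runs through three branch vertices, of length at least \<open>3 n\<close>, whereas the distances of these
  points sum to at most \<open>3 m\<close>.\<close>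

lemma clique_on_star:
  assumes pairs: "\<And>x y. x \<in> K \<Longrightarrow> y \<in> K \<Longrightarrow> x \<noteq> y \<Longrightarrow> edge_near G n m x y \<or> star_near G n m x y"
    and pq: "p \<in> K" "q \<in> K" "p \<noteq> q" "\<not> edge_near G n n p q" and m: "m < n"
  obtains u v w i j where "(u, v) \<in> parcs G" "(u, w) \<in> parcs G" "v \<noteq> w" "0 < i" "i \<le> n" "0 < j" "j \<le> n"
    "p = subdiv_point n u v i" "q = subdiv_point n u w j"
    "\<forall>r\<in>K. \<exists>x s. (u, x) \<in> parcs G \<and> s \<le> n \<and> r = subdiv_point n u x s"
proof -
  have "\<not> edge_near G n m p q"
    using pq(4) edge_near_mono[of G n m p q n] m by auto
  then obtain u v w i j where uv: "(u, v) \<in> parcs G" and uw: "(u, w) \<in> parcs G" and ij: "i + j \<le> m"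
    and p: "p = subdiv_point n u v i" and q: "q = subdiv_point n u w j"
    using pairs[OF pq(1-3)] unfolding star_near_def by blast
  have ends: "\<not> ((u, x) \<in> parcs G \<and> p = subdiv_point n u x s \<and> q = subdiv_point n u x t \<and> s \<le> n \<and> t \<le> n)"
    for x s t
    using pq(4) unfolding edge_near_def
    by (metis trans_le_add2)
  have vw: "v \<noteq> w"
    using ends[of v i j] uv p q ij m by auto
  \<comment> \<open>For \<open>i = 0\<close> the point \<open>p\<close> is \<open>u\<close>, which
    also lies on the leg \<open>w\<close> of \<open>q\<close>.\<close>
  have i0: "0 < i"
    using ends[of w 0 j] uw p q ij m by (cases i) (auto simp: subdiv_point_def)
  have j0: "0 < j"
    using ends[of v i 0] uv p q ij m by (cases j) (auto simp: subdiv_point_def)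
  \<comment> \<open>From index \<open>k\<close> on leg \<open>x\<close>, a short walk either ends on
    the star of \<open>u\<close> or leaves through \<open>x\<close>, after \<open>n - k\<close>
    arcs.\<close>
  have far: "(\<exists>y s. (u, y) \<in> parcs G \<and> s \<le> n \<and> r = subdiv_point n u y s) \<or>
      (\<exists>y t. (x, y) \<in> parcs G \<and> r = subdiv_point n x y t \<and> n - k + t \<le> m)"
    if near: "edge_near G n m (subdiv_point n u x k) r \<or> star_near G n m (subdiv_point n u x k) r"
      and ux: "(u, x) \<in> parcs G" and k: "0 < k" "k \<le> m" for r x k
    using near
  proof
    assume "edge_near G n m (subdiv_point n u x k) r"
    then show ?thesis
      using edge_near_inner[of n m u x k r] ux k m by (metis le_less_trans)
  next
    assume "star_near G n m (subdiv_point n u x k) r"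
    then obtain a b c s t where abc: "(a, b) \<in> parcs G" "(a, c) \<in> parcs G" "s + t \<le> m"
      "subdiv_point n u x k = subdiv_point n a b s" and r: "r = subdiv_point n a c t"
      unfolding star_near_def by blast
    then have "a = u \<or> a = x \<and> s = n - k"
      using subdiv_point_eq_cases[of n u x k a b s] pair_arc_neq ux k m by auto
    then show ?thesis
    proof
      assume "a = u"
      moreover have "t \<le> n" using abc(3) m by simp
      ultimately show ?thesis using abc(2) r by blast
    next
      assume "a = x \<and> s = n - k"
      then show ?thesis using abc r by blast
    qed
  qed
  have "\<exists>x s. (u, x) \<in> parcs G \<and> s \<le> n \<and> r = subdiv_point n u x s" if r: "r \<in> K" for r
  proof (rule ccontr)
    assume no: "\<not> ?thesis"
    have "r \<noteq> p" "r \<noteq> q"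
      using no uv uw p q ij m by (metis add_leD1 add_leD2 le_trans less_imp_le)+
    then obtain y z t t' where y: "(v, y) \<in> parcs G" "r = subdiv_point n v y t" "n - i + t \<le> m"
      and z: "(w, z) \<in> parcs G" "r = subdiv_point n w z t'" "n - j + t' \<le> m"
      using far[of v i r] far[of w j r] no pairs[OF pq(1) r] pairs[OF pq(2) r] uv uw i0 j0 ij p q
      by fastforce
    have "n \<le> t + t'"
      using subdiv_point_two_ends[of n v y t w z t'] y z vw pair_arc_neq m by auto
    \<comment> \<open>Adding \<open>n - i + t \<le> m\<close>, \<open>n - j + t' \<le> m\<close> and
      \<open>i + j \<le> m\<close> gives \<open>2 n + t + t' \<le> 3 m\<close>, hence
      \<open>3 n \<le> 3 m\<close>.\<close>
    then show False using y(3) z(3) ij m by linarith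
  qed
  then show thesis
    using that[OF uv uw vw i0 _ j0 _ p q] ij m by simp
qed

section \<open>Degrees and the upper bound\<close>

lemma card_neighbours: "card {v. (u, v) \<in> parcs G} = out_degree (with_proj G) u"
proof -
  have "out_arcs (with_proj G) u = Pair u ` {v. (u, v) \<in> parcs G}"
    by (auto simp: out_arcs_def)
  then show ?thesis
    by (simp add: out_degree_def card_image inj_on_def)
qed

lemma finite_neighbours: "finite {v. (u, v) \<in> parcs G}"
  by (rule finite_subset[of _ "pverts G"]) (auto simp: pair_finite_verts dest: in_arcsD2)

lemma card_neighbours_le:
  assumes "u \<in> pverts G"
  shows "card {v. (u, v) \<in> parcs G} \<le> max_degree G"
  unfolding max_degree_def card_neighbours
  using assms pair_finite_verts by (intro cSUP_upper) auto

lemma max_degree_attained: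
  assumes "0 < max_degree G"
  obtains u where "u \<in> pverts G" "card {v. (u, v) \<in> parcs G} = max_degree G"
proof -
  \<comment> \<open>Without vertices the supremum would be 0.\<close>
  have "pverts G \<noteq> {}"
    using assms by (auto simp: max_degree_def)
  then have "max_degree G \<in> out_degree (with_proj G) ` pverts G"
    unfolding max_degree_def using pair_finite_verts by (simp add: cSup_eq_Max)
  then show thesis
    using that card_neighbours by auto
qed

text \<open>The first alternative comes from cliques on one edge, the second from cliques in a star.
  Two occupied legs of the star force \<open>2 \<le> max_degree G\<close>, which rules out the
  second alternative for maximum degree 1.\<close>

lemma clique_card_le:
  assumes K: "is_clique (fractional_power m n G) K" and m: "m < n"
  shows "card K \<le> m + 1 \<or>
    2 \<le> max_degree G \<and> card K \<le> (m div 2) * max_degree G + m mod 2 + 1"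
proof -
  have pairs: "edge_near G n m x y \<or> star_near G n m x y" if "x \<in> K" "y \<in> K" "x \<noteq> y" for x y
  proof -
    obtain k where k: "k \<le> m" "(x, y) \<in> parcs (edge_subdivision n G) ^^ k"
      using K \<open>x \<in> K\<close> \<open>y \<in> K\<close> \<open>x \<noteq> y\<close>
      unfolding is_clique_fractional_power[OF pair_graph_axioms] by blast
    then have "edge_near G n k x y \<or> star_near G n k x y"
      using relpow_edge_subdivision_near[of x y k n] k m \<open>x \<noteq> y\<close> by simp
    then show ?thesis
      using edge_near_mono[OF _ k(1)] star_near_mono[OF _ k(1)] by blast
  qed
  show ?thesis
  proof (cases "\<exists>p\<in>K. \<exists>q\<in>K. p \<noteq> q")
    case False
    then have "card K \<le> 1"
      by (cases "finite K") (auto simp: card_le_Suc0_iff_eq)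
    then show ?thesis by simp
  next
    case True
    then obtain p q where pq: "p \<in> K" "q \<in> K" "p \<noteq> q" by blast
    show ?thesis
    proof (cases "\<forall>x\<in>K. \<forall>y\<in>K. x \<noteq> y \<longrightarrow> edge_near G n n x y")
      case True
      then have common: "\<And>x y. x \<in> K \<Longrightarrow> y \<in> K \<Longrightarrow> x \<noteq> y \<Longrightarrow> edge_near G n n x y"
        by blast
      obtain u v where uv: "(u, v) \<in> parcs G" and sub: "K \<subseteq> subdiv_point n u v ` {..n}"
        by (rule clique_on_edge[OF pairs common pq m])
      define I where "I = {i. i \<le> n \<and> subdiv_point n u v i \<in> K}"
      have "i \<le> j + m" if "i \<in> I" "j \<in> I" for i j
      proof (cases "subdiv_point n u v i = subdiv_point n u v j")
        case True
        \<comment> \<open>As \<open>pairs\<close> speaks of distinct points only, equal points are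
          settled by injectivity of the index along the edge.\<close>
        then have "i = j"
          using that pair_arc_neq[OF uv]
          by (auto simp: I_def subdiv_point_def doubleton_eq_iff split: if_splits)
        then show ?thesis by simp
      next
        case False
        then show ?thesis
          using near_on_edge[of n m u v i j] pairs uv m that by (simp add: I_def)
      qed
      then have "card I \<le> m + 1" by (rule card_le_of_diameter)
      moreover have "K = subdiv_point n u v ` I" "finite I"
        using sub by (auto simp: I_def)
      ultimately show ?thesis
        using card_image_le[of I "subdiv_point n u v"] by simp
    next
      case False
      then obtain p q where pq': "p \<in> K" "q \<in> K" "p \<noteq> q" "\<not> edge_near G n n p q" by blast
      obtain u v w i j where uv: "(u, v) \<in> parcs G" and uw: "(u, w) \<in> parcs G" and vw: "v \<noteq> w"
        and i: "0 < i" "i \<le> n" and j: "0 < j" "j \<le> n"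
        and p: "p = subdiv_point n u v i" and q: "q = subdiv_point n u w j"
        and star: "\<forall>r\<in>K. \<exists>x s. (u, x) \<in> parcs G \<and> s \<le> n \<and> r = subdiv_point n u x s"
        by (rule clique_on_star[OF pairs pq' m])
      define N where "N = {v. (u, v) \<in> parcs G}"
      \<comment> \<open>Index 0 is left out: it is \<open>Branch u\<close> on every leg and is
        counted once, as the final 1.\<close>
      define A where "A x = {s. 0 < s \<and> s \<le> n \<and> subdiv_point n u x s \<in> K}" for x
      have u: "u \<in> pverts G" using uv in_arcsD1 by blast
      have N: "finite N" "card N \<le> max_degree G"
        unfolding N_def using finite_neighbours card_neighbours_le[OF u] by auto
      have two: "2 \<le> max_degree G"
        using N card_mono[of N "{v, w}"] uv uw vw by (simp add: N_def)
      have cross: "s + t \<le> m" if "x \<in> N" "y \<in> N" "x \<noteq> y" "s \<in> A x" "t \<in> A y" for x y s t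
      proof -
        have "subdiv_point n u x s \<noteq> subdiv_point n u y t"
          using subdiv_point_same_leg[of n u x s y t] pair_arc_neq that by (auto simp: N_def A_def)
        then show ?thesis
          using near_on_star[of n m u x s y t] pairs that m by (auto simp: N_def A_def)
      qed
      have finA: "finite (A x)" for x by (auto simp: A_def)
      have "K \<subseteq> insert (Branch u) (\<Union>x\<in>N. subdiv_point n u x ` A x)"
      proof
        fix r assume "r \<in> K"
        then obtain x s where "(u, x) \<in> parcs G" "s \<le> n" "r = subdiv_point n u x s"
          using star by blast
        then show "r \<in> insert (Branch u) (\<Union>x\<in>N. subdiv_point n u x ` A x)"
          using \<open>r \<in> K\<close> by (cases "s = 0") (auto simp: N_def A_def subdiv_point_def)
      qed
      then have "card K \<le> card (insert (Branch u) (\<Union>x\<in>N. subdiv_point n u x ` A x))"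
        using N finA by (intro card_mono) auto
      also have "\<dots> \<le> Suc (card (\<Union>x\<in>N. subdiv_point n u x ` A x))"
        by (rule card_insert_le_m1) auto
      also have "card (\<Union>x\<in>N. subdiv_point n u x ` A x) \<le> (\<Sum>x\<in>N. card (subdiv_point n u x ` A x))"
        by (rule card_UN_le) (rule N)
      also have "\<dots> \<le> (\<Sum>x\<in>N. card (A x))"
        using finA by (intro sum_mono card_image_le)
      \<comment> \<open>The points \<open>p\<close> and \<open>q\<close> make the legs
        \<open>v\<close> and \<open>w\<close> nonempty.\<close>
      also have "\<dots> \<le> (m div 2) * max_degree G + m mod 2"
        using N cross uv uw vw i j p q pq'(1,2)
        by (intro sum_legs_le[of N _ A m v w]) (auto simp: N_def A_def)
      finally show ?thesis using two by simp
    qed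
  qed
qed

section \<open>Cliques that attain the bounds\<close>

lemma clique_of_edge:
  assumes uv: "(u, v) \<in> parcs G" and m: "m < n"
  shows "is_clique (fractional_power m n G) (subdiv_point n u v ` {..m})"
    and "card (subdiv_point n u v ` {..m}) = m + 1"
proof -
  have near: "(subdiv_point n u v i, subdiv_point n u v j) \<in> parcs (edge_subdivision n G) ^^ (j - i)"
    "(subdiv_point n u v j, subdiv_point n u v i) \<in> parcs (edge_subdivision n G) ^^ (j - i)"
    if "i \<le> j" "j \<le> m" for i j
    using that m relpow_along_edge[OF uv, of i "j - i" n] relpow_along_edge_rev[OF uv, of i "j - i" n]
    by auto
  have "\<exists>k\<le>m. (subdiv_point n u v i, subdiv_point n u v j) \<in> parcs (edge_subdivision n G) ^^ k"
    if "i \<le> m" "j \<le> m" for i j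
    using that near(1)[of i j] near(2)[of j i] by (cases "i \<le> j") (meson diff_le_self le_trans nat_le_linear)+
  moreover have "subdiv_point n u v ` {..m} \<subseteq> pverts (edge_subdivision n G)"
    using m subdiv_point_in_verts[OF uv] by auto
  ultimately show "is_clique (fractional_power m n G) (subdiv_point n u v ` {..m})"
    unfolding is_clique_fractional_power[OF pair_graph_axioms] by blast
  have "inj_on (subdiv_point n u v) {..m}"
    using m pair_arc_neq[OF uv]
    by (auto simp: inj_on_def subdiv_point_def doubleton_eq_iff split: if_splits)
  then show "card (subdiv_point n u v ` {..m}) = m + 1"
    by (simp add: card_image)
qed

text \<open>The ball of radius \<open>m div 2\<close> around \<open>u\<close>, for odd
  \<open>m\<close> with one further point on leg \<open>v\<close>. At most one index exceeds
  \<open>m div 2\<close>, so the indices of two distinct points sum to at most \<open>m\<close>, and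
  the walk through \<open>u\<close> is short enough.\<close>

lemma clique_of_star:
  assumes u: "u \<in> pverts G" and uv: "(u, v) \<in> parcs G" and m: "m < n"
  obtains K where "is_clique (fractional_power m n G) K"
    "card K = (m div 2) * card {w. (u, w) \<in> parcs G} + m mod 2 + 1"
proof -
  define N where "N = {w. (u, w) \<in> parcs G}"
  \<comment> \<open>Pairs of a leg and an index, without the centre. The second interval is empty
    for even \<open>m\<close> and holds just \<open>m div 2 + 1\<close> for odd
    \<open>m\<close>.\<close>
  define P where "P = N \<times> {1..m div 2} \<union> {v} \<times> {m div 2<..m div 2 + m mod 2}"
  define f where "f = (\<lambda>(w, i). subdiv_point n u w i)"
  have finN: "finite N" unfolding N_def by (rule finite_neighbours)
  have P: "w \<in> N" "0 < i" "i < n" if "(w, i) \<in> P" for w i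
    using that uv m by (auto simp: P_def N_def)
  have sum: "i + j \<le> m" if "(w, i) \<in> P" "(x, j) \<in> P" "(w, i) \<noteq> (x, j)" for w x i j
  proof -
    have "i \<le> m div 2 \<or> j \<le> m div 2" "i \<le> m div 2 + m mod 2" "j \<le> m div 2 + m mod 2"
      using that by (auto simp: P_def)
    then show ?thesis
      using div_mult_mod_eq[of m 2] by linarith
  qed
  have inj: "inj_on f P"
  proof (rule inj_onI, clarify)
    fix w i x j assume wx: "(w, i) \<in> P" "(x, j) \<in> P" "f (w, i) = f (x, j)"
    then show "w = x \<and> i = j"
      using subdiv_point_same_leg[of n u w i x j] P[OF wx(1)] P[OF wx(2)] pair_arc_neq
      by (simp add: f_def N_def)
  qed
  have branch: "Branch u \<notin> f ` P"
    by (auto simp: f_def subdiv_point_def split: if_splits dest: P)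
  have cardP: "card P = (m div 2) * card N + m mod 2"
    unfolding P_def using finN by (subst card_Un_disjoint) (auto simp: card_cartesian_product)
  have finP: "finite P" unfolding P_def using finN by simp
  have verts: "insert (Branch u) (f ` P) \<subseteq> pverts (edge_subdivision n G)"
  proof -
    have "subdiv_point n u w i \<in> pverts (edge_subdivision n G)" if "(w, i) \<in> P" for w i
      using P[OF that] subdiv_point_in_verts[of u w i n] by (simp add: N_def)
    moreover have "Branch u \<in> pverts (edge_subdivision n G)"
      using u by (simp add: edge_subdivision_def)
    ultimately show ?thesis
      by (auto simp: f_def)
  qed
  \<comment> \<open>The walk through \<open>u\<close> also serves two points of the same
    leg.\<close>
  have near: "\<exists>k\<le>m. (subdiv_point n u w i, subdiv_point n u x j) \<in> parcs (edge_subdivision n G) ^^ k"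
    if "w \<in> N" "x \<in> N" "i \<le> n" "j \<le> n" "i + j \<le> m" for w x i j
    using that relpow_through_branch[of u w x i n j] by (auto simp: N_def)
  have center: "\<exists>k\<le>m. (Branch u, subdiv_point n u w i) \<in> parcs (edge_subdivision n G) ^^ k"
    "\<exists>k\<le>m. (subdiv_point n u w i, Branch u) \<in> parcs (edge_subdivision n G) ^^ k"
    if "(w, i) \<in> P" for w i
  proof -
    have "w \<in> N" "i \<le> m" "i \<le> n" using P[OF that] that by (auto simp: P_def)
    moreover have "Branch u = subdiv_point n u w 0" by (simp add: subdiv_point_def)
    ultimately show "\<exists>k\<le>m. (Branch u, subdiv_point n u w i) \<in> parcs (edge_subdivision n G) ^^ k"
      "\<exists>k\<le>m. (subdiv_point n u w i, Branch u) \<in> parcs (edge_subdivision n G) ^^ k"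
      using near[of w w 0 i] near[of w w i 0] by simp_all
  qed
  have "is_clique (fractional_power m n G) (insert (Branch u) (f ` P))"
    unfolding is_clique_fractional_power[OF pair_graph_axioms]
  proof (intro conjI ballI impI verts)
    fix x y assume xy: "x \<in> insert (Branch u) (f ` P)" "y \<in> insert (Branch u) (f ` P)" "x \<noteq> y"
    then consider w i where "x = Branch u" "(w, i) \<in> P" "y = subdiv_point n u w i"
      | w i where "y = Branch u" "(w, i) \<in> P" "x = subdiv_point n u w i"
      | w i z j where "(w, i) \<in> P" "x = subdiv_point n u w i" "(z, j) \<in> P" "y = subdiv_point n u z j"
      by (auto simp: f_def)
    then show "\<exists>k\<le>m. (x, y) \<in> parcs (edge_subdivision n G) ^^ k"
    proof cases
      case 3
      then show ?thesis
        using near[of w z i j] sum[of w i z j] P[of w i] P[of z j] xy(3) by auto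
    qed (use center in auto)
  qed
  moreover have "card (insert (Branch u) (f ` P)) = (m div 2) * card N + m mod 2 + 1"
    using finP branch by (simp add: card_image[OF inj] cardP)
  ultimately show thesis using that unfolding N_def by blast
qed

section \<open>The clique number\<close>

lemma finite_pverts_fractional_power: "finite (pverts (fractional_power m n G))"
proof -
  interpret S: pair_graph "edge_subdivision n G"
    by (rule pair_graph_edge_subdivision[OF pair_graph_axioms])
  show ?thesis
    using S.pair_finite_verts by (simp add: fractional_power_def graph_power_def)
qed

lemma max_degree_arc:
  assumes "0 < max_degree G"
  obtains u v where "u \<in> pverts G" "(u, v) \<in> parcs G" "card {v. (u, v) \<in> parcs G} = max_degree G"
proof -
  obtain u where u: "u \<in> pverts G" "card {v. (u, v) \<in> parcs G} = max_degree G"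
    using max_degree_attained assms by blast
  then have "{v. (u, v) \<in> parcs G} \<noteq> {}" using assms by (metis card.empty less_numeral_extra(3))
  then show thesis using that u by blast
qed

lemma clique_number_fractional_power_1:
  assumes "max_degree G = 1" "m < n"
  shows "clique_number (fractional_power m n G) = m + 1"
proof -
  have "0 < max_degree G" using assms(1) by simp
  then obtain u v where uv: "(u, v) \<in> parcs G"
    by (rule max_degree_arc)
  show ?thesis
  proof (rule clique_number_eqI)
    show "card K \<le> m + 1" if "is_clique (fractional_power m n G) K" for K
      using clique_card_le[OF that assms(2)] assms(1) by simp
  qed (use finite_pverts_fractional_power clique_of_edge[OF uv assms(2)] in auto)
qed

lemma clique_number_fractional_power_ge_2:
  assumes "2 \<le> max_degree G" "m < n"
  shows "clique_number (fractional_power m n G) = (m div 2) * max_degree G + m mod 2 + 1"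
proof -
  have "0 < max_degree G" using assms(1) by simp
  then obtain u v where u: "u \<in> pverts G" "(u, v) \<in> parcs G"
    "card {v. (u, v) \<in> parcs G} = max_degree G"
    by (rule max_degree_arc)
  obtain L where L: "is_clique (fractional_power m n G) L"
    "card L = (m div 2) * max_degree G + m mod 2 + 1"
    using clique_of_star[OF u(1,2) assms(2)] u(3) by auto
  \<comment> \<open>For maximum degree at least 2, the star bound is no smaller than the edge bound
    \<open>m + 1\<close>.\<close>
  have "m = (m div 2) * 2 + m mod 2" by simp
  also have "\<dots> \<le> (m div 2) * max_degree G + m mod 2"
    using assms(1) by (intro add_right_mono mult_left_mono) auto
  finally have le: "m + 1 \<le> (m div 2) * max_degree G + m mod 2 + 1" by simp
  show ?thesis
  proof (rule clique_number_eqI)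
    show "card K \<le> (m div 2) * max_degree G + m mod 2 + 1"
      if "is_clique (fractional_power m n G) K" for K
      using clique_card_le[OF that assms(2)] le by linarith
  qed (use finite_pverts_fractional_power L in auto)
qed

end

theorem theorem1:
  fixes G :: "'a pair_pre_digraph" and m n :: nat
  assumes "pair_graph G" and "m < n"
  shows "(max_degree G = 1 \<longrightarrow> clique_number (fractional_power m n G) = m + 1) \<and>
    (max_degree G \<ge> 2 \<and> even m \<longrightarrow>
       real (clique_number (fractional_power m n G)) = real m / 2 * real (max_degree G) + 1) \<and>
    (max_degree G \<ge> 2 \<and> odd m \<longrightarrow>
       real (clique_number (fractional_power m n G)) = (real m - 1) / 2 * real (max_degree G) + 2)"
proof -
  interpret pair_graph G by fact
  show ?thesis
    \<comment> \<open>Writing \<open>m\<close> as \<open>2 k\<close> or \<open>2 k + 1\<close> makes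
      \<open>m div 2\<close> equal to \<open>k\<close>, that is to \<open>m / 2\<close> or
      \<open>(m - 1) / 2\<close>; the remainder turns the constant 1 into 2 for odd
      \<open>m\<close>.\<close>
    using clique_number_fractional_power_1[of m n] clique_number_fractional_power_ge_2[of m n] assms(2)
    by (auto elim!: evenE oddE)
qed

end
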